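(* A parameterized program $\mathcal{P}=\{(P_i,[\![-]\!]_i)\}_{i\in\mathcal{I}}$ is safe if there is a universal structure $\mathbb{T}$ for $\mathcal{P}$ and a valid $\mathbb{T}$-proof space $\mathcal{H}$ such that $\bigcup_{i\in\mathcal{I}}\mathcal{L}_{\mathrm{err}}(P_i)\subseteq\mathcal{L}(\mathcal{H})$.
   Context: For a structure and a set $V$ of elements, $N(V)$ is the substructure generated by $V$; $N(\vec a)$ that of the entries of tuple $\vec a$; juxtaposition of tuples is concatenation. A local isomorphism from $\vec a$ to $\vec b$ (same length, structures over the same vocabulary) is an isomorphism $\beta:N(\vec a)\to N(\vec b)$ with $\beta(\vec a)=\vec b$; $\vec a\simeq\vec b$ if one exists. Programs. Fix a vocabulary $\mathcal{V}_{\mathsf{Node}}$, a data domain $\mathbb{D}$ (structure over vocabulary $\mathcal{V}_{\mathsf{Data}}$), a finite command set $\Sigma$, a finite location set $\mathbf{L}$ with distinguished $l_{\mathrm{init}},l_{\mathrm{err}}$, and $\mathsf{src},\mathsf{tgt}:\Sigma\to\mathbf{L}$. A topology is a $\mathcal{V}_{\mathsf{Node}}$-structure $\mathbb{T}$. A program over $\mathbb{T}$ is $(P,[\![-]\!])$ with $P:\mathbb{T}\to2^\Sigma$ and relations $[\![\sigma:v]\!]\subseteq(N(v)\to\mathbb{D})^2$ for $\langle\sigma:v\rangle\in\Sigma\times\mathbb{T}$. For location maps $\lambda,\lambda':\mathbb{T}\to\mathbf{L}$, $\lambda\xrightarrow{\sigma:v}\lambda'$ iff $\sigma\in P(v)$,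 $\lambda(v)=\mathsf{src}(\sigma)$, and $\lambda'$ equals $\lambda$ except $\lambda'(v)=\mathsf{tgt}(\sigma)$. The error runs $\mathcal{L}_{\mathrm{err}}(P)$ are the words $\langle\sigma_1:a_1\rangle\cdots\langle\sigma_n:a_n\rangle$ for which there are location maps $\lambda_0\equiv l_{\mathrm{init}},\lambda_1,\dots,\lambda_n$ with $\lambda_{r-1}\xrightarrow{\sigma_r:a_r}\lambda_r$ and $l_{\mathrm{err}}$ in the range of $\lambda_n$. For $V\supseteq N(v)$, $\mathsf{Global}_V[\![\sigma:v]\!]$ is the set of pairs of valuations $V\to\mathbb{D}$ whose restrictions to $N(v)$ lie in $[\![\sigma:v]\!]$ and which agree outside $N(v)$, extended to words by relational composition. A run $\rho$ is infeasible if $\mathsf{Global}_{\mathbb{T}}[\![\rho]\!]=\emptyset$; a program is safe if all its error runs are infeasible. For a local isomorphism $\beta:N(\vec a)\to N(\vec b)$, $\beta^*\nu=\nu\circ\beta$, lifted to pairs and sets. A parameterized program is a family of programs $(P_i,[\![-]\!]_i)$ over topologies $\mathbb{T}_i$ ($i\in\mathcal{I}$; common $\mathcal{V}_{\mathsf{Node}},\mathbb{D},\Sigma,\mathbf{L}$) such that for any $a\in\mathbb{T}_i$, $a'\in\mathbb{T}_j$ and local isomorphism $\beta$ from $a$ to $a'$: $P_i(a)=P_j(a')$ and $[\![\sigma:a]\!]_i=\beta^*[\![\sigma:a']\!]_j$ for all $\sigma$. It is safe if every member is safe. A universal structure is a $\mathcal{V}_{\mathsf{Node}}$-structure $\mathbb{T}$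 in which every $\mathbb{T}_i$ embeds; each $\mathbb{T}_i$ is identified with a substructure of $\mathbb{T}$, so $\mathcal{L}_{\mathrm{err}}(P_i)\subseteq(\Sigma\times\mathbb{T})^*$. Semantics on $\mathbb{T}$: $[\![\sigma:v]\!]=\beta^*[\![\sigma:u]\!]_i$ if some $u\in\mathbb{T}_i$ and local isomorphism $\beta$ from $v$ to $u$ exist, else $\emptyset$. Hoare triples and proof spaces. An assertion is $\phi[\mu(u_1),\dots,\mu(u_m)]$ ($\phi$ a $\mathcal{V}_{\mathsf{Data}}$-formula, $u_j\in\mathbb{T}$, $\mu$ formal); a valuation $\nu$ satisfies it if $\mathbb{D}\models\phi[\nu(u_1),\dots,\nu(u_m)]$. A triple $\{\phi[\overrightarrow{\mu(u)}]\}\,\rho\,\{\psi[\overrightarrow{\mu(w)}]\}$, $\rho=\langle\sigma_1:v_1\rangle\cdots\langle\sigma_n:v_n\rangle$, is valid if with $V=N(\vec u\vec v\vec w)$, every $(\nu,\nu')\in\mathsf{Global}_V[\![\rho]\!]$ with $\nu$ satisfying the precondition has $\nu'$ satisfying the postcondition. Rules (assertions viewed as conjunctions of conjuncts): Sequencing — from $\{A_1\}\rho_1\{A_2\}$, $\{A_2'\}\rho_2\{A_3\}$ with every conjunct of $A_2'$ a conjunct of $A_2$, derive $\{A_1\}\rho_1\rho_2\{A_3\}$; Conjunction — from $\{A_1\}\rho\{B_1\}$, $\{A_2\}\rho\{B_2\}$ derive $\{A_1\wedge A_2\}\rho\{B_1\wedge B_2\}$; S-param — from $\{\phi[\overrightarrow{\mu(u)}]\}\langle\sigma_1:v_1\rangle\cdots\langle\sigma_n:v_n\rangle\{\psi[\overrightarrow{\mu(w)}]\}$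 derive the triple with $\vec u',\vec v',\vec w'$ in place of $\vec u,\vec v,\vec w$ whenever lengths agree and $\vec u\vec v\vec w\simeq\vec u'\vec v'\vec w'$. A $\mathbb{T}$-proof space is a set of triples closed under these rules; valid if all its triples are valid; its language is $\mathcal{L}(\mathcal{H})=\{\rho:\{\top\}\rho\{\bot\}\in\mathcal{H}\}$. *)

theory Defs
  imports Main "HOL-Library.FuncSet"
begin

section \<open>Structures, generated substructures, local isomorphisms\<close>

text \<open>Constants are function symbols of arity 0.\<close>

record ('f, 'r) vocabulary =
  fun_syms :: "'f set"
  rel_syms :: "'r set"
  fun_ar :: "'f \<Rightarrow> nat"
  rel_ar :: "'r \<Rightarrow> nat"

text \<open>
  Only the values of \<open>fun_int M f\<close> on tuples over the carrier whose length is the arity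
  of \<open>f\<close> are meaningful.  Empty carriers are allowed: without constants the
  substructure generated by the empty set is empty.
\<close>

record ('a, 'f, 'r) struct =
  carrier :: "'a set"
  fun_int :: "'f \<Rightarrow> 'a list \<Rightarrow> 'a"
  rel_int :: "'r \<Rightarrow> 'a list set"

definition tuples :: "'a set \<Rightarrow> nat \<Rightarrow> 'a list set" where
  "tuples A n = {xs. set xs \<subseteq> A \<and> length xs = n}"

definition is_structure :: "('f, 'r) vocabulary \<Rightarrow> ('a, 'f, 'r) struct \<Rightarrow> bool" where
  "is_structure \<V> M \<longleftrightarrow>
     (\<forall>f\<in>fun_syms \<V>. \<forall>xs\<in>tuples (carrier M) (fun_ar \<V> f). fun_int M f xs \<in> carrier M) \<and>
     (\<forall>r\<in>rel_syms \<V>. rel_int M r \<subseteq> tuples (carrier M) (rel_ar \<V> r))"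

inductive_set generated_set ::
  "('f, 'r) vocabulary \<Rightarrow> ('a, 'f, 'r) struct \<Rightarrow> 'a set \<Rightarrow> 'a set"
  for \<V> :: "('f, 'r) vocabulary" and M :: "('a, 'f, 'r) struct" and A :: "'a set"
where
  base: "x \<in> A \<Longrightarrow> x \<in> generated_set \<V> M A"
| app: "\<lbrakk>f \<in> fun_syms \<V>; length xs = fun_ar \<V> f; \<And>x. x \<in> set xs \<Longrightarrow> x \<in> generated_set \<V> M A\<rbrakk>
    \<Longrightarrow> fun_int M f xs \<in> generated_set \<V> M A"

definition gen_sub ::
  "('f, 'r) vocabulary \<Rightarrow> ('a, 'f, 'r) struct \<Rightarrow> 'a set \<Rightarrow> ('a, 'f, 'r) struct" where
  "gen_sub \<V> M A =
     \<lparr>carrier = generated_set \<V> M A,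
      fun_int = fun_int M,
      rel_int = (\<lambda>r. {xs \<in> rel_int M r. set xs \<subseteq> generated_set \<V> M A})\<rparr>"

definition embedding ::
  "('f, 'r) vocabulary \<Rightarrow> ('a, 'f, 'r) struct \<Rightarrow> ('b, 'f, 'r) struct \<Rightarrow> ('a \<Rightarrow> 'b) \<Rightarrow> bool" where
  "embedding \<V> M M' h \<longleftrightarrow>
     h \<in> carrier M \<rightarrow> carrier M' \<and> inj_on h (carrier M) \<and>
     (\<forall>f\<in>fun_syms \<V>. \<forall>xs\<in>tuples (carrier M) (fun_ar \<V> f).
        h (fun_int M f xs) = fun_int M' f (map h xs)) \<and>
     (\<forall>r\<in>rel_syms \<V>. \<forall>xs\<in>tuples (carrier M) (rel_ar \<V> r).
        xs \<in> rel_int M r \<longleftrightarrow> map h xs \<in> rel_int M' r)"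

definition isomorphism ::
  "('f, 'r) vocabulary \<Rightarrow> ('a, 'f, 'r) struct \<Rightarrow> ('b, 'f, 'r) struct \<Rightarrow> ('a \<Rightarrow> 'b) \<Rightarrow> bool" where
  "isomorphism \<V> M M' h \<longleftrightarrow> embedding \<V> M M' h \<and> h ` carrier M = carrier M'"

definition local_iso ::
  "('f, 'r) vocabulary \<Rightarrow> ('a, 'f, 'r) struct \<Rightarrow> 'a list \<Rightarrow> ('b, 'f, 'r) struct \<Rightarrow> 'b list
    \<Rightarrow> ('a \<Rightarrow> 'b) \<Rightarrow> bool" where
  "local_iso \<V> M as M' bs \<beta> \<longleftrightarrow>
     set as \<subseteq> carrier M \<and> set bs \<subseteq> carrier M' \<and> length as = length bs \<and>
     isomorphism \<V> (gen_sub \<V> M (set as)) (gen_sub \<V> M' (set bs)) \<beta> \<and> map \<beta> as = bs"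

definition locally_isomorphic ::
  "('f, 'r) vocabulary \<Rightarrow> ('a, 'f, 'r) struct \<Rightarrow> 'a list \<Rightarrow> ('b, 'f, 'r) struct \<Rightarrow> 'b list
    \<Rightarrow> bool" where
  "locally_isomorphic \<V> M as M' bs \<longleftrightarrow> (\<exists>\<beta>. local_iso \<V> M as M' bs \<beta>)"


section \<open>First-order formulas\<close>

text \<open>
  Bound variables are de Bruijn indices; free variables come from the type \<open>'x\<close>.
  With \<open>'x = nat\<close> these are ordinary formulas \<open>\<phi>(x\<^sub>0, \<dots>, x\<^sub>m\<^sub>-\<^sub>1)\<close>; with \<open>'x\<close> the type of
  nodes they are assertions, and the free variable \<open>u\<close> stands for the formal term \<open>\<mu>(u)\<close>.
\<close>

datatype (dead 'f, tm_vars: 'x) tm =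
  Free 'x
| Bound nat
| App 'f "('f, 'x) tm list"
for map: map_tm

datatype (dead 'f, dead 'r, fm_vars: 'x) fm =
  Tru
| Fls
| Eq "('f, 'x) tm" "('f, 'x) tm"
| Rel 'r "('f, 'x) tm list"
| Neg "('f, 'r, 'x) fm"
| And "('f, 'r, 'x) fm" "('f, 'r, 'x) fm"
| Or "('f, 'r, 'x) fm" "('f, 'r, 'x) fm"
| Imp "('f, 'r, 'x) fm" "('f, 'r, 'x) fm"
| All "('f, 'r, 'x) fm"
| Ex "('f, 'r, 'x) fm"
for map: map_fm

fun wf_tm :: "('f, 'r) vocabulary \<Rightarrow> nat \<Rightarrow> ('f, 'x) tm \<Rightarrow> bool" where
  "wf_tm \<V> k (Free x) \<longleftrightarrow> True"
| "wf_tm \<V> k (Bound n) \<longleftrightarrow> n < k"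
| "wf_tm \<V> k (App f ts) \<longleftrightarrow>
     f \<in> fun_syms \<V> \<and> length ts = fun_ar \<V> f \<and> (\<forall>t\<in>set ts. wf_tm \<V> k t)"

text \<open>The number \<open>k\<close> counts the enclosing quantifiers.\<close>

fun wf_fm :: "('f, 'r) vocabulary \<Rightarrow> nat \<Rightarrow> ('f, 'r, 'x) fm \<Rightarrow> bool" where
  "wf_fm \<V> k Tru \<longleftrightarrow> True"
| "wf_fm \<V> k Fls \<longleftrightarrow> True"
| "wf_fm \<V> k (Eq s t) \<longleftrightarrow> wf_tm \<V> k s \<and> wf_tm \<V> k t"
| "wf_fm \<V> k (Rel r ts) \<longleftrightarrow>
     r \<in> rel_syms \<V> \<and> length ts = rel_ar \<V> r \<and> (\<forall>t\<in>set ts. wf_tm \<V> k t)"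
| "wf_fm \<V> k (Neg A) \<longleftrightarrow> wf_fm \<V> k A"
| "wf_fm \<V> k (And A B) \<longleftrightarrow> wf_fm \<V> k A \<and> wf_fm \<V> k B"
| "wf_fm \<V> k (Or A B) \<longleftrightarrow> wf_fm \<V> k A \<and> wf_fm \<V> k B"
| "wf_fm \<V> k (Imp A B) \<longleftrightarrow> wf_fm \<V> k A \<and> wf_fm \<V> k B"
| "wf_fm \<V> k (All A) \<longleftrightarrow> wf_fm \<V> (Suc k) A"
| "wf_fm \<V> k (Ex A) \<longleftrightarrow> wf_fm \<V> (Suc k) A"

fun eval_tm :: "('d, 'f, 'r) struct \<Rightarrow> ('x \<Rightarrow> 'd) \<Rightarrow> 'd list \<Rightarrow> ('f, 'x) tm \<Rightarrow> 'd" where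
  "eval_tm D \<nu> env (Free x) = \<nu> x"
| "eval_tm D \<nu> env (Bound n) = env ! n"
| "eval_tm D \<nu> env (App f ts) = fun_int D f (map (eval_tm D \<nu> env) ts)"

fun eval_fm :: "('d, 'f, 'r) struct \<Rightarrow> ('x \<Rightarrow> 'd) \<Rightarrow> 'd list \<Rightarrow> ('f, 'r, 'x) fm \<Rightarrow> bool" where
  "eval_fm D \<nu> env Tru \<longleftrightarrow> True"
| "eval_fm D \<nu> env Fls \<longleftrightarrow> False"
| "eval_fm D \<nu> env (Eq s t) \<longleftrightarrow> eval_tm D \<nu> env s = eval_tm D \<nu> env t"
| "eval_fm D \<nu> env (Rel r ts) \<longleftrightarrow> map (eval_tm D \<nu> env) ts \<in> rel_int D r"
| "eval_fm D \<nu> env (Neg A) \<longleftrightarrow> \<not> eval_fm D \<nu> env A"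
| "eval_fm D \<nu> env (And A B) \<longleftrightarrow> eval_fm D \<nu> env A \<and> eval_fm D \<nu> env B"
| "eval_fm D \<nu> env (Or A B) \<longleftrightarrow> eval_fm D \<nu> env A \<or> eval_fm D \<nu> env B"
| "eval_fm D \<nu> env (Imp A B) \<longleftrightarrow> (eval_fm D \<nu> env A \<longrightarrow> eval_fm D \<nu> env B)"
| "eval_fm D \<nu> env (All A) \<longleftrightarrow> (\<forall>d\<in>carrier D. eval_fm D \<nu> (d # env) A)"
| "eval_fm D \<nu> env (Ex A) \<longleftrightarrow> (\<exists>d\<in>carrier D. eval_fm D \<nu> (d # env) A)"

definition satisfies :: "('d, 'f, 'r) struct \<Rightarrow> ('x \<Rightarrow> 'd) \<Rightarrow> ('f, 'r, 'x) fm \<Rightarrow> bool" where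
  "satisfies D \<nu> A \<longleftrightarrow> eval_fm D \<nu> [] A"

text \<open>The assertion \<open>\<phi>[\<mu>(u\<^sub>0), \<dots>, \<mu>(u\<^sub>m\<^sub>-\<^sub>1)]\<close>.\<close>

definition inst :: "('f, 'r, nat) fm \<Rightarrow> 'u list \<Rightarrow> ('f, 'r, 'u) fm" where
  "inst \<phi> us = map_fm (\<lambda>j. us ! j) \<phi>"

fun conjuncts :: "('f, 'r, 'x) fm \<Rightarrow> ('f, 'r, 'x) fm set" where
  "conjuncts (And A B) = conjuncts A \<union> conjuncts B"
| "conjuncts A = {A}"


section \<open>Programs\<close>

record ('nf, 'nr, 'df, 'dr, 'd, 's, 'l) setting =
  node_voc :: "('nf, 'nr) vocabulary"
  data_voc :: "('df, 'dr) vocabulary"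
  data_dom :: "('d, 'df, 'dr) struct"
  cmds :: "'s set"
  locs :: "'l set"
  l_init :: 'l
  l_err :: 'l
  src :: "'s \<Rightarrow> 'l"
  tgt :: "'s \<Rightarrow> 'l"

definition wf_setting :: "('nf, 'nr, 'df, 'dr, 'd, 's, 'l) setting \<Rightarrow> bool" where
  "wf_setting S \<longleftrightarrow>
     is_structure (data_voc S) (data_dom S) \<and> finite (cmds S) \<and> finite (locs S) \<and>
     l_init S \<in> locs S \<and> l_err S \<in> locs S \<and>
     src S \<in> cmds S \<rightarrow> locs S \<and> tgt S \<in> cmds S \<rightarrow> locs S"

text \<open>Valuations \<open>V \<rightarrow> \<D>\<close> are the extensional functions \<open>V \<rightarrow>\<^sub>E carrier \<D>\<close>.\<close>

type_synonym ('n, 'd) trans = "(('n \<Rightarrow> 'd) \<times> ('n \<Rightarrow> 'd)) set"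

record ('n, 'nf, 'nr, 's, 'd) program =
  topology :: "('n, 'nf, 'nr) struct"
  cmds_at :: "'n \<Rightarrow> 's set"
  sem :: "'s \<Rightarrow> 'n \<Rightarrow> ('n, 'd) trans"

definition nbhd :: "('f, 'r) vocabulary \<Rightarrow> ('a, 'f, 'r) struct \<Rightarrow> 'a \<Rightarrow> 'a set" where
  "nbhd \<V> M v = carrier (gen_sub \<V> M {v})"

definition is_program ::
  "('nf, 'nr, 'df, 'dr, 'd, 's, 'l) setting \<Rightarrow> ('n, 'nf, 'nr, 's, 'd) program \<Rightarrow> bool" where
  "is_program S P \<longleftrightarrow>
     is_structure (node_voc S) (topology P) \<and>
     (\<forall>v\<in>carrier (topology P). cmds_at P v \<subseteq> cmds S) \<and>
     (\<forall>\<sigma>\<in>cmds S. \<forall>v\<in>carrier (topology P).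
        sem P \<sigma> v \<subseteq> (nbhd (node_voc S) (topology P) v \<rightarrow>\<^sub>E carrier (data_dom S)) \<times>
                    (nbhd (node_voc S) (topology P) v \<rightarrow>\<^sub>E carrier (data_dom S)))"

definition loc_step ::
  "('nf, 'nr, 'df, 'dr, 'd, 's, 'l) setting \<Rightarrow> ('n, 'nf, 'nr, 's, 'd) program
    \<Rightarrow> ('n \<Rightarrow> 'l) \<Rightarrow> 's \<times> 'n \<Rightarrow> ('n \<Rightarrow> 'l) \<Rightarrow> bool" where
  "loc_step S P \<kappa> p \<kappa>' \<longleftrightarrow>
     (case p of (\<sigma>, v) \<Rightarrow>
        v \<in> carrier (topology P) \<and> \<sigma> \<in> cmds_at P v \<and>
        \<kappa> v = src S \<sigma> \<and> \<kappa>' = \<kappa>(v := tgt S \<sigma>))"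

definition error_runs ::
  "('nf, 'nr, 'df, 'dr, 'd, 's, 'l) setting \<Rightarrow> ('n, 'nf, 'nr, 's, 'd) program
    \<Rightarrow> ('s \<times> 'n) list set" where
  "error_runs S P =
     {\<rho>. \<exists>\<kappa> :: nat \<Rightarrow> 'n \<Rightarrow> 'l.
        (\<forall>k\<le>length \<rho>. \<kappa> k \<in> carrier (topology P) \<rightarrow>\<^sub>E locs S) \<and>
        \<kappa> 0 = (\<lambda>v\<in>carrier (topology P). l_init S) \<and>
        (\<forall>k<length \<rho>. loc_step S P (\<kappa> k) (\<rho> ! k) (\<kappa> (Suc k))) \<and>
        l_err S \<in> \<kappa> (length \<rho>) ` carrier (topology P)}"

text \<open>
  The semantics is a separate argument, since \<open>Global\<close> is used both for the members of a
  parameterized program and for the universal structure.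
\<close>

definition Global1 ::
  "('nf, 'nr, 'df, 'dr, 'd, 's, 'l) setting \<Rightarrow> ('n, 'nf, 'nr) struct
    \<Rightarrow> ('s \<Rightarrow> 'n \<Rightarrow> ('n, 'd) trans) \<Rightarrow> 'n set \<Rightarrow> 's \<times> 'n \<Rightarrow> ('n, 'd) trans" where
  "Global1 S M sm V p =
     (case p of (\<sigma>, v) \<Rightarrow>
        {(\<nu>, \<nu>'). \<nu> \<in> V \<rightarrow>\<^sub>E carrier (data_dom S) \<and> \<nu>' \<in> V \<rightarrow>\<^sub>E carrier (data_dom S) \<and>
           (restrict \<nu> (nbhd (node_voc S) M v), restrict \<nu>' (nbhd (node_voc S) M v)) \<in> sm \<sigma> v \<and>
           (\<forall>x\<in>V - nbhd (node_voc S) M v. \<nu> x = \<nu>' x)})"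

primrec Global ::
  "('nf, 'nr, 'df, 'dr, 'd, 's, 'l) setting \<Rightarrow> ('n, 'nf, 'nr) struct
    \<Rightarrow> ('s \<Rightarrow> 'n \<Rightarrow> ('n, 'd) trans) \<Rightarrow> 'n set \<Rightarrow> ('s \<times> 'n) list \<Rightarrow> ('n, 'd) trans" where
  "Global S M sm V [] = Id_on (V \<rightarrow>\<^sub>E carrier (data_dom S))"
| "Global S M sm V (p # \<rho>) = Global1 S M sm V p O Global S M sm V \<rho>"

definition infeasible ::
  "('nf, 'nr, 'df, 'dr, 'd, 's, 'l) setting \<Rightarrow> ('n, 'nf, 'nr, 's, 'd) program
    \<Rightarrow> ('s \<times> 'n) list \<Rightarrow> bool" where
  "infeasible S P \<rho> \<longleftrightarrow> Global S (topology P) (sem P) (carrier (topology P)) \<rho> = {}"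

definition safe ::
  "('nf, 'nr, 'df, 'dr, 'd, 's, 'l) setting \<Rightarrow> ('n, 'nf, 'nr, 's, 'd) program \<Rightarrow> bool" where
  "safe S P \<longleftrightarrow> (\<forall>\<rho>\<in>error_runs S P. infeasible S P \<rho>)"


section \<open>Parameterized programs and universal structures\<close>

text \<open>The set \<open>\<beta>\<^sup>* R\<close> for \<open>\<beta>\<close> with domain \<open>A\<close>.\<close>

definition pullback :: "'a set \<Rightarrow> ('a \<Rightarrow> 'b) \<Rightarrow> ('b, 'd) trans \<Rightarrow> ('a, 'd) trans" where
  "pullback A \<beta> R = (\<lambda>(\<nu>, \<nu>'). (compose A \<nu> \<beta>, compose A \<nu>' \<beta>)) ` R"

definition parameterized_program ::
  "('nf, 'nr, 'df, 'dr, 'd, 's, 'l) setting \<Rightarrow> 'i set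
    \<Rightarrow> ('i \<Rightarrow> ('n, 'nf, 'nr, 's, 'd) program) \<Rightarrow> bool" where
  "parameterized_program S I P \<longleftrightarrow>
     wf_setting S \<and> (\<forall>i\<in>I. is_program S (P i)) \<and>
     (\<forall>i\<in>I. \<forall>j\<in>I. \<forall>a\<in>carrier (topology (P i)). \<forall>a'\<in>carrier (topology (P j)). \<forall>\<beta>.
        local_iso (node_voc S) (topology (P i)) [a] (topology (P j)) [a'] \<beta> \<longrightarrow>
        cmds_at (P i) a = cmds_at (P j) a' \<and>
        (\<forall>\<sigma>\<in>cmds S. sem (P i) \<sigma> a =
           pullback (nbhd (node_voc S) (topology (P i)) a) \<beta> (sem (P j) \<sigma> a')))"

definition safe_parameterized ::
  "('nf, 'nr, 'df, 'dr, 'd, 's, 'l) setting \<Rightarrow> 'i set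
    \<Rightarrow> ('i \<Rightarrow> ('n, 'nf, 'nr, 's, 'd) program) \<Rightarrow> bool" where
  "safe_parameterized S I P \<longleftrightarrow> (\<forall>i\<in>I. safe S (P i))"

text \<open>
  The embeddings \<open>e i\<close> that identify the topologies with substructures of the universal
  structure are kept explicit.
\<close>

definition universal_structure ::
  "('nf, 'nr, 'df, 'dr, 'd, 's, 'l) setting \<Rightarrow> 'i set
    \<Rightarrow> ('i \<Rightarrow> ('n, 'nf, 'nr, 's, 'd) program) \<Rightarrow> ('u, 'nf, 'nr) struct
    \<Rightarrow> ('i \<Rightarrow> 'n \<Rightarrow> 'u) \<Rightarrow> bool" where
  "universal_structure S I P T e \<longleftrightarrow>
     is_structure (node_voc S) T \<and>
     (\<forall>i\<in>I. embedding (node_voc S) (topology (P i)) T (e i))"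

definition embed_word :: "('n \<Rightarrow> 'u) \<Rightarrow> ('s \<times> 'n) list \<Rightarrow> ('s \<times> 'u) list" where
  "embed_word h \<rho> = map (\<lambda>(\<sigma>, a). (\<sigma>, h a)) \<rho>"

text \<open>
  For a parameterized program \<open>\<beta>\<^sup>* [\<sigma> : u]\<^sub>i\<close> does not depend on the choice of \<open>i\<close>, \<open>u\<close> and
  \<open>\<beta>\<close>, so the description below is proper for \<open>\<sigma> \<in> cmds S\<close>.
\<close>

definition univ_sem ::
  "('nf, 'nr, 'df, 'dr, 'd, 's, 'l) setting \<Rightarrow> 'i set
    \<Rightarrow> ('i \<Rightarrow> ('n, 'nf, 'nr, 's, 'd) program) \<Rightarrow> ('u, 'nf, 'nr) struct
    \<Rightarrow> 's \<Rightarrow> 'u \<Rightarrow> ('u, 'd) trans" where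
  "univ_sem S I P T \<sigma> v =
     (if \<exists>i\<in>I. \<exists>u\<in>carrier (topology (P i)). \<exists>\<beta>.
           local_iso (node_voc S) T [v] (topology (P i)) [u] \<beta>
      then THE R. \<exists>i\<in>I. \<exists>u\<in>carrier (topology (P i)). \<exists>\<beta>.
           local_iso (node_voc S) T [v] (topology (P i)) [u] \<beta> \<and>
           R = pullback (nbhd (node_voc S) T v) \<beta> (sem (P i) \<sigma> u)
      else {})"


section \<open>Hoare triples and proof spaces\<close>

type_synonym ('df, 'dr, 's, 'u) triple =
  "('df, 'dr, 'u) fm \<times> ('s \<times> 'u) list \<times> ('df, 'dr, 'u) fm"

definition is_assertion ::
  "('nf, 'nr, 'df, 'dr, 'd, 's, 'l) setting \<Rightarrow> ('u, 'nf, 'nr) struct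
    \<Rightarrow> ('df, 'dr, 'u) fm \<Rightarrow> bool" where
  "is_assertion S T A \<longleftrightarrow> wf_fm (data_voc S) 0 A \<and> fm_vars A \<subseteq> carrier T"

definition is_triple ::
  "('nf, 'nr, 'df, 'dr, 'd, 's, 'l) setting \<Rightarrow> ('u, 'nf, 'nr) struct
    \<Rightarrow> ('df, 'dr, 's, 'u) triple \<Rightarrow> bool" where
  "is_triple S T t \<longleftrightarrow>
     (case t of (A, \<rho>, B) \<Rightarrow>
        is_assertion S T A \<and> set \<rho> \<subseteq> cmds S \<times> carrier T \<and> is_assertion S T B)"

definition valid_triple ::
  "('nf, 'nr, 'df, 'dr, 'd, 's, 'l) setting \<Rightarrow> 'i set
    \<Rightarrow> ('i \<Rightarrow> ('n, 'nf, 'nr, 's, 'd) program) \<Rightarrow> ('u, 'nf, 'nr) struct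
    \<Rightarrow> ('df, 'dr, 's, 'u) triple \<Rightarrow> bool" where
  "valid_triple S I P T t \<longleftrightarrow>
     (case t of (A, \<rho>, B) \<Rightarrow>
        let V = carrier (gen_sub (node_voc S) T (fm_vars A \<union> snd ` set \<rho> \<union> fm_vars B)) in
        \<forall>(\<nu>, \<nu>')\<in>Global S T (univ_sem S I P T) V \<rho>.
          satisfies (data_dom S) \<nu> A \<longrightarrow> satisfies (data_dom S) \<nu>' B)"

definition closed_sequencing :: "('df, 'dr, 's, 'u) triple set \<Rightarrow> bool" where
  "closed_sequencing H \<longleftrightarrow>
     (\<forall>A1 \<rho>1 A2 A2' \<rho>2 A3.
        (A1, \<rho>1, A2) \<in> H \<and> (A2', \<rho>2, A3) \<in> H \<and> conjuncts A2' \<subseteq> conjuncts A2 \<longrightarrow>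
        (A1, \<rho>1 @ \<rho>2, A3) \<in> H)"

definition closed_conjunction :: "('df, 'dr, 's, 'u) triple set \<Rightarrow> bool" where
  "closed_conjunction H \<longleftrightarrow>
     (\<forall>A1 A2 \<rho> B1 B2.
        (A1, \<rho>, B1) \<in> H \<and> (A2, \<rho>, B2) \<in> H \<longrightarrow> (And A1 A2, \<rho>, And B1 B2) \<in> H)"

definition closed_S_param ::
  "('nf, 'nr, 'df, 'dr, 'd, 's, 'l) setting \<Rightarrow> ('u, 'nf, 'nr) struct
    \<Rightarrow> ('df, 'dr, 's, 'u) triple set \<Rightarrow> bool" where
  "closed_S_param S T H \<longleftrightarrow>
     (\<forall>\<phi> \<psi> \<sigma>s us vs ws us' vs' ws'.
        fm_vars \<phi> \<subseteq> {..<length us} \<and> fm_vars \<psi> \<subseteq> {..<length ws} \<and> length \<sigma>s = length vs \<and>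
        length us = length us' \<and> length vs = length vs' \<and> length ws = length ws' \<and>
        locally_isomorphic (node_voc S) T (us @ vs @ ws) T (us' @ vs' @ ws') \<and>
        (inst \<phi> us, zip \<sigma>s vs, inst \<psi> ws) \<in> H \<longrightarrow>
        (inst \<phi> us', zip \<sigma>s vs', inst \<psi> ws') \<in> H)"

definition proof_space ::
  "('nf, 'nr, 'df, 'dr, 'd, 's, 'l) setting \<Rightarrow> ('u, 'nf, 'nr) struct
    \<Rightarrow> ('df, 'dr, 's, 'u) triple set \<Rightarrow> bool" where
  "proof_space S T H \<longleftrightarrow>
     (\<forall>t\<in>H. is_triple S T t) \<and>
     closed_sequencing H \<and> closed_conjunction H \<and> closed_S_param S T H"

definition valid_proof_space ::
  "('nf, 'nr, 'df, 'dr, 'd, 's, 'l) setting \<Rightarrow> 'i set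
    \<Rightarrow> ('i \<Rightarrow> ('n, 'nf, 'nr, 's, 'd) program) \<Rightarrow> ('u, 'nf, 'nr) struct
    \<Rightarrow> ('df, 'dr, 's, 'u) triple set \<Rightarrow> bool" where
  "valid_proof_space S I P T H \<longleftrightarrow>
     proof_space S T H \<and> (\<forall>t\<in>H. valid_triple S I P T t)"

definition proof_space_lang :: "('df, 'dr, 's, 'u) triple set \<Rightarrow> ('s \<times> 'u) list set" where
  "proof_space_lang H = {\<rho>. (Tru, \<rho>, Fls) \<in> H}"

end

theory Submission
  imports Defs
begin

text \<open>
  A feasible error run of a member \<open>P\<^sub>i\<close>, transported along the embedding of \<open>\<T>\<^sub>i\<close> into \<open>\<T>\<close>,
  is feasible on every set of nodes that lies in the image of \<open>\<T>\<^sub>i\<close> and contains the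
  neighbourhoods of the acting nodes, because the semantics on \<open>\<T>\<close> pulls back to the one of
  \<open>P\<^sub>i\<close>.  The set \<open>N(v\<^sub>1 \<dots> v\<^sub>n)\<close> used in the validity of \<open>{\<top>} \<rho> {\<bottom>}\<close> is such a set, so a valid
  triple of this form rules the run out.
\<close>

section \<open>Generated sets and embeddings\<close>

lemma generated_set_subset_carrier:
  assumes "is_structure \<V> M" and "A \<subseteq> carrier M"
  shows "generated_set \<V> M A \<subseteq> carrier M"
proof
  fix x assume "x \<in> generated_set \<V> M A"
  then show "x \<in> carrier M"
  proof induction
    case (app f xs)
    then show ?case
      using assms(1) by (simp add: is_structure_def tuples_def subset_iff)
  qed (use assms in auto)
qed

lemma generated_set_mono:
  assumes "A \<subseteq> B"
  shows "generated_set \<V> M A \<subseteq> generated_set \<V> M B"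
proof
  fix x assume "x \<in> generated_set \<V> M A"
  then show "x \<in> generated_set \<V> M B"
    by induction (use assms in \<open>auto intro: generated_set.intros\<close>)
qed

lemma nbhd_eq: "nbhd \<V> M v = generated_set \<V> M {v}"
  by (simp add: nbhd_def gen_sub_def)

text \<open>Both inclusions go by induction on generation. An embedding commutes with a function
  symbol only on tuples over the carrier, so each induction also uses that generated elements stay
  in \<open>carrier M\<close>.\<close>

lemma generated_set_image_embedding:
  assumes M: "is_structure \<V> M" and h: "embedding \<V> M M' h" and A: "A \<subseteq> carrier M"
  shows "generated_set \<V> M' (h ` A) = h ` generated_set \<V> M A"
proof (intro equalityI subsetI)
  note sub = generated_set_subset_carrier[OF M A]
  fix y assume "y \<in> generated_set \<V> M' (h ` A)"
  then show "y \<in> h ` generated_set \<V> M A"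
  proof induction
    case (base x)
    then show ?case by (auto intro: generated_set.base)
  next
    case (app f ys)
    have "\<forall>y\<in>set ys. \<exists>x\<in>generated_set \<V> M A. y = h x"
      using app.IH by blast
    \<comment> \<open>Choosing a preimage for each entry of \<open>ys\<close> lifts the whole tuple
      to \<open>M\<close>, where \<open>f\<close> can be applied before mapping back with
      \<open>h\<close>.\<close>
    then obtain g where g: "\<forall>y\<in>set ys. g y \<in> generated_set \<V> M A \<and> y = h (g y)"
      by metis
    define xs where "xs = map g ys"
    have ys: "ys = map h xs"
      using g by (simp add: xs_def map_idI)
    have xs: "set xs \<subseteq> generated_set \<V> M A" "length xs = fun_ar \<V> f"
      using g app.hyps by (auto simp: xs_def)
    have "h (fun_int M f xs) = fun_int M' f ys"
      using h xs sub app.hyps ys by (auto simp: embedding_def tuples_def)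
    moreover have "fun_int M f xs \<in> generated_set \<V> M A"
      using xs app.hyps by (auto intro: generated_set.app)
    ultimately show ?case by force
  qed
next
  note sub = generated_set_subset_carrier[OF M A]
  fix y assume "y \<in> h ` generated_set \<V> M A"
  then obtain x where "x \<in> generated_set \<V> M A" and y: "y = h x" by blast
  from this(1) have "h x \<in> generated_set \<V> M' (h ` A)"
  proof induction
    case (base x)
    then show ?case by (auto intro: generated_set.base)
  next
    case (app f xs)
    have "h (fun_int M f xs) = fun_int M' f (map h xs)"
      using h sub app.hyps by (auto simp: embedding_def tuples_def subset_iff)
    then show ?case
      using app by (auto intro!: generated_set.app)
  qed
  with y show "y \<in> generated_set \<V> M' (h ` A)" by simp
qed

lemma embedding_imp_local_iso:
  assumes M: "is_structure \<V> M" and h: "embedding \<V> M M' h" and as: "set as \<subseteq> carrier M"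
  shows "local_iso \<V> M as M' (map h as) h"
proof -
  note sub = generated_set_subset_carrier[OF M as]
  have img: "generated_set \<V> M' (set (map h as)) = h ` generated_set \<V> M (set as)"
    using generated_set_image_embedding[OF M h as] by simp
  have "embedding \<V> (gen_sub \<V> M (set as)) (gen_sub \<V> M' (set (map h as))) h"
    unfolding embedding_def
  proof (intro conjI ballI)
    show "inj_on h (carrier (gen_sub \<V> M (set as)))"
      using h sub by (auto simp: embedding_def gen_sub_def intro: inj_on_subset)
  next
    fix f xs assume "f \<in> fun_syms \<V>" "xs \<in> tuples (carrier (gen_sub \<V> M (set as))) (fun_ar \<V> f)"
    then show "h (fun_int (gen_sub \<V> M (set as)) f xs) =
        fun_int (gen_sub \<V> M' (set (map h as))) f (map h xs)"
      using h sub by (auto simp: embedding_def gen_sub_def tuples_def)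
  next
    fix r xs assume "r \<in> rel_syms \<V>" "xs \<in> tuples (carrier (gen_sub \<V> M (set as))) (rel_ar \<V> r)"
    then have "xs \<in> rel_int M r \<longleftrightarrow> map h xs \<in> rel_int M' r"
      and "set xs \<subseteq> generated_set \<V> M (set as)"
      using h sub by (auto simp: embedding_def gen_sub_def tuples_def)
    \<comment> \<open>\<open>gen_sub\<close> also demands that tuples of a relation lie in the
      generated set; by \<open>img\<close> this holds for \<open>map h xs\<close> as it does for
      \<open>xs\<close>.\<close>
    then show "xs \<in> rel_int (gen_sub \<V> M (set as)) r \<longleftrightarrow>
        map h xs \<in> rel_int (gen_sub \<V> M' (set (map h as))) r"
      using img by (auto simp: gen_sub_def)
  qed (use img in \<open>simp add: gen_sub_def\<close>)
  moreover have "h ` set as \<subseteq> carrier M'"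
    using h as by (auto simp: embedding_def)
  ultimately show ?thesis
    using as img by (simp add: local_iso_def isomorphism_def) (simp add: gen_sub_def)
qed

section \<open>Inverses and composites of isomorphisms\<close>

text \<open>The conditions on \<open>g\<close> at a tuple \<open>ys\<close> are those on
  \<open>h\<close> at \<open>map g ys\<close>. For a function symbol, \<open>cl\<close> keeps the
  value in \<open>carrier M\<close>, so that \<open>g\<close> cancels \<open>h\<close> there;
  generated substructures satisfy \<open>cl\<close> by construction.\<close>

lemma isomorphism_inverse:
  assumes h: "isomorphism \<V> M M' h"
    and cl: "\<And>f xs. f \<in> fun_syms \<V> \<Longrightarrow> xs \<in> tuples (carrier M) (fun_ar \<V> f) \<Longrightarrow> fun_int M f xs \<in> carrier M"
    and g: "\<And>x. x \<in> carrier M \<Longrightarrow> g (h x) = x"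
  shows "isomorphism \<V> M' M g"
proof -
  have car: "carrier M' = h ` carrier M"
    using h by (simp add: isomorphism_def)
  have hg: "h (g y) = y" "g y \<in> carrier M" if "y \<in> carrier M'" for y
    using that car g by auto
  have map_hg: "map h (map g ys) = ys" "map g ys \<in> tuples (carrier M) n"
    if "ys \<in> tuples (carrier M') n" for ys n
    using that hg by (auto simp: tuples_def subset_iff intro: map_idI)
  have "embedding \<V> M' M g"
    unfolding embedding_def
  proof (intro conjI ballI)
    show "inj_on g (carrier M')"
      by (metis hg(1) inj_onI)
  next
    fix f ys assume f: "f \<in> fun_syms \<V>" and ys: "ys \<in> tuples (carrier M') (fun_ar \<V> f)"
    have "h (fun_int M f (map g ys)) = fun_int M' f ys"
      using h f map_hg[OF ys] by (metis embedding_def isomorphism_def)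
    then show "g (fun_int M' f ys) = fun_int M f (map g ys)"
      using g cl f map_hg(2)[OF ys] by metis
  next
    fix r ys assume r: "r \<in> rel_syms \<V>" and ys: "ys \<in> tuples (carrier M') (rel_ar \<V> r)"
    then show "ys \<in> rel_int M' r \<longleftrightarrow> map g ys \<in> rel_int M r"
      using h map_hg[OF ys] by (metis embedding_def isomorphism_def)
  qed (use hg in auto)
  moreover have "g ` carrier M' = carrier M"
    using car g by force
  ultimately show ?thesis by (simp add: isomorphism_def)
qed

text \<open>Here \<open>g\<close> may be any left inverse on the generated set. This allows the
  inverse of an embedding of a whole topology to serve as the local inverse at every node.\<close>

lemma local_iso_inverse:
  assumes h: "local_iso \<V> M as M' bs h"
    and g: "\<And>x. x \<in> generated_set \<V> M (set as) \<Longrightarrow> g (h x) = x"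
  shows "local_iso \<V> M' bs M as g"
proof -
  have "isomorphism \<V> (gen_sub \<V> M' (set bs)) (gen_sub \<V> M (set as)) g"
  proof (rule isomorphism_inverse)
    show "isomorphism \<V> (gen_sub \<V> M (set as)) (gen_sub \<V> M' (set bs)) h"
      using h by (simp add: local_iso_def)
  qed (use g in \<open>auto simp: gen_sub_def tuples_def intro!: generated_set.app\<close>)
  moreover have "map g bs = as"
    using h g[OF generated_set.base] by (auto simp: local_iso_def intro!: map_idI)
  ultimately show ?thesis
    using h by (auto simp: local_iso_def)
qed

lemma isomorphism_comp:
  assumes h: "isomorphism \<V> M M' h" and g: "isomorphism \<V> M' M'' g"
  shows "isomorphism \<V> M M'' (g \<circ> h)"
proof -
  have car: "carrier M' = h ` carrier M" "carrier M'' = g ` carrier M'"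
    using h g by (simp_all add: isomorphism_def)
  have tup: "map h xs \<in> tuples (carrier M') n" if "xs \<in> tuples (carrier M) n" for xs n
    using that car by (auto simp: tuples_def)
  have "embedding \<V> M M'' (g \<circ> h)"
    unfolding embedding_def
  proof (intro conjI ballI)
    show "inj_on (g \<circ> h) (carrier M)"
      using h g car by (simp add: isomorphism_def embedding_def comp_inj_on)
  next
    fix f xs assume "f \<in> fun_syms \<V>" "xs \<in> tuples (carrier M) (fun_ar \<V> f)"
    then show "(g \<circ> h) (fun_int M f xs) = fun_int M'' f (map (g \<circ> h) xs)"
      using h g tup by (simp add: isomorphism_def embedding_def)
  next
    fix r xs assume "r \<in> rel_syms \<V>" "xs \<in> tuples (carrier M) (rel_ar \<V> r)"
    then show "xs \<in> rel_int M r \<longleftrightarrow> map (g \<circ> h) xs \<in> rel_int M'' r"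
      using h g tup by (simp add: isomorphism_def embedding_def)
  qed (use car in auto)
  then show ?thesis
    using car by (simp add: isomorphism_def image_comp)
qed

lemma local_iso_comp:
  assumes "local_iso \<V> M as M' bs h" and "local_iso \<V> M' bs M'' cs g"
  shows "local_iso \<V> M as M'' cs (g \<circ> h)"
proof -
  have "isomorphism \<V> (gen_sub \<V> M (set as)) (gen_sub \<V> M'' (set cs)) (g \<circ> h)"
    using assms isomorphism_comp unfolding local_iso_def by blast
  then show ?thesis
    using assms unfolding local_iso_def by (metis list.map_comp)
qed

lemma local_iso_image_nbhd:
  assumes "local_iso \<V> M [a] M' [b] h"
  shows "h ` nbhd \<V> M a = nbhd \<V> M' b"
  using assms by (simp add: local_iso_def isomorphism_def nbhd_def)

section \<open>Pullbacks of transition relations\<close>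

text \<open>The inner \<open>compose\<close> is \<open>undefined\<close> off \<open>B\<close>; since
  \<beta> maps \<open>A\<close> into \<open>B\<close>, the outer one never reads such a
  value.\<close>

lemma pullback_pullback:
  assumes "\<beta> ` A \<subseteq> B"
  shows "pullback A \<beta> (pullback B \<gamma> R) = pullback A (\<gamma> \<circ> \<beta>) (R :: ('c, 'd) trans)"
proof -
  have "compose A (compose B \<nu> \<gamma>) \<beta> = compose A \<nu> (\<gamma> \<circ> \<beta>)" for \<nu> :: "'c \<Rightarrow> 'd"
    using assms by (auto simp: compose_def restrict_def fun_eq_iff)
  then show ?thesis
    by (simp add: pullback_def image_image case_prod_unfold)
qed

text \<open>Needed because going back along an embedding and forth again is the identity only on the
  image, not as a function on the whole type.\<close>

lemma pullback_cong:
  assumes "\<And>x. x \<in> A \<Longrightarrow> \<beta> x = \<gamma> x"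
  shows "pullback A \<beta> R = pullback A \<gamma> (R :: ('b, 'c) trans)"
proof -
  have "compose A \<nu> \<beta> = compose A \<nu> \<gamma>" for \<nu> :: "'b \<Rightarrow> 'c"
    using assms by (auto simp: compose_def restrict_def)
  then show ?thesis by (simp add: pullback_def)
qed

section \<open>Semantics on the universal structure\<close>

text \<open>The inverse embedding is one local isomorphism from \<open>e i v\<close> into the
  family. Any other one, \<beta>, gives the same pullback: \<open>\<beta> \<circ> e i\<close> is a
  local isomorphism between members, so their compatibility relates the two semantics, and pulling
  back along the inverse cancels \<open>e i\<close>. Hence the description in
  \<open>univ_sem\<close> is proper and has this value.\<close>

lemma univ_sem_embedding:
  assumes pp: "parameterized_program S I P" and us: "universal_structure S I P T e"
    and i: "i \<in> I" and v: "v \<in> carrier (topology (P i))" and \<sigma>: "\<sigma> \<in> cmds S"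
  shows "univ_sem S I P T \<sigma> (e i v) =
    pullback (nbhd (node_voc S) T (e i v)) (inv_into (carrier (topology (P i))) (e i)) (sem (P i) \<sigma> v)"
proof -
  let ?\<V> = "node_voc S" and ?M = "topology (P i)"
  let ?g = "inv_into (carrier ?M) (e i)"
  have M: "is_structure ?\<V> ?M"
    using pp i by (simp add: parameterized_program_def is_program_def)
  have e: "embedding ?\<V> ?M T (e i)"
    using us i by (simp add: universal_structure_def)
  then have inj: "inj_on (e i) (carrier ?M)"
    by (simp add: embedding_def)
  have ge: "?g (e i x) = x" if "x \<in> nbhd ?\<V> ?M v" for x
    using that generated_set_subset_carrier[OF M] v inj by (force simp: nbhd_eq)
  have iso: "local_iso ?\<V> ?M [v] T [e i v] (e i)"
    using embedding_imp_local_iso[OF M e, of "[v]"] v by simp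
  then have inv_iso: "local_iso ?\<V> T [e i v] ?M [v] ?g"
    by (rule local_iso_inverse) (use ge in \<open>simp add: nbhd_eq\<close>)
  have "pullback (nbhd ?\<V> T (e i v)) \<beta> (sem (P j) \<sigma> u) =
      pullback (nbhd ?\<V> T (e i v)) ?g (sem (P i) \<sigma> v)"
    if j: "j \<in> I" and u: "u \<in> carrier (topology (P j))"
      and \<beta>: "local_iso ?\<V> T [e i v] (topology (P j)) [u] \<beta>" for j u \<beta>
  proof -
    have "sem (P i) \<sigma> v = pullback (nbhd ?\<V> ?M v) (\<beta> \<circ> e i) (sem (P j) \<sigma> u)"
      using pp i j u v \<sigma> local_iso_comp[OF iso \<beta>] unfolding parameterized_program_def by blast
    then have "pullback (nbhd ?\<V> T (e i v)) ?g (sem (P i) \<sigma> v) =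
        pullback (nbhd ?\<V> T (e i v)) (\<beta> \<circ> e i \<circ> ?g) (sem (P j) \<sigma> u)"
      using local_iso_image_nbhd[OF inv_iso] by (simp add: pullback_pullback)
    also have "\<dots> = pullback (nbhd ?\<V> T (e i v)) \<beta> (sem (P j) \<sigma> u)"
    proof (rule pullback_cong)
      fix y assume "y \<in> nbhd ?\<V> T (e i v)"
      then obtain x where "x \<in> nbhd ?\<V> ?M v" "y = e i x"
        using local_iso_image_nbhd[OF iso] by blast
      then show "(\<beta> \<circ> e i \<circ> ?g) y = \<beta> y"
        using ge by simp
    qed
    finally show ?thesis by simp
  qed
  then have "(THE R. \<exists>j\<in>I. \<exists>u\<in>carrier (topology (P j)). \<exists>\<beta>.
      local_iso ?\<V> T [e i v] (topology (P j)) [u] \<beta> \<and>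
      R = pullback (nbhd ?\<V> T (e i v)) \<beta> (sem (P j) \<sigma> u)) =
    pullback (nbhd ?\<V> T (e i v)) ?g (sem (P i) \<sigma> v)"
    \<comment> \<open>Existence is witnessed by \<open>i\<close>, \<open>v\<close> and
      \<open>?g\<close>; uniqueness is the independence just shown.\<close>
    using i v inv_iso by (intro the_equality) (blast, metis)
  moreover have "\<exists>j\<in>I. \<exists>u\<in>carrier (topology (P j)). \<exists>\<beta>.
      local_iso ?\<V> T [e i v] (topology (P j)) [u] \<beta>"
    using i v inv_iso by blast
  ultimately show ?thesis
    by (simp add: univ_sem_def)
qed

text \<open>Each step survives the passage from the whole topology to \<open>V\<close>: as
  \<open>V\<close> contains the neighbourhood of the acting node, the command still sees all it
  reads and writes, and nodes elsewhere do not change. As \<open>V\<close> lies in the image of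
  \<open>e i\<close>, the transported valuations take values in the data domain.\<close>

lemma Global_embedding:
  assumes pp: "parameterized_program S I P" and us: "universal_structure S I P T e" and i: "i \<in> I"
    and \<rho>: "set \<rho> \<subseteq> cmds S \<times> carrier (topology (P i))"
    and V: "V \<subseteq> e i ` carrier (topology (P i))"
    and nb: "\<And>v. v \<in> snd ` set \<rho> \<Longrightarrow> nbhd (node_voc S) T (e i v) \<subseteq> V"
    and G: "(\<nu>, \<nu>') \<in> Global S (topology (P i)) (sem (P i)) (carrier (topology (P i))) \<rho>"
  shows "(compose V \<nu> (inv_into (carrier (topology (P i))) (e i)),
          compose V \<nu>' (inv_into (carrier (topology (P i))) (e i)))
    \<in> Global S T (univ_sem S I P T) V (embed_word (e i) \<rho>)"
  using \<rho> nb G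
proof (induction \<rho> arbitrary: \<nu>)
  let ?\<V> = "node_voc S" and ?M = "topology (P i)"
  let ?g = "inv_into (carrier ?M) (e i)"
  have g: "?g y \<in> carrier ?M" if "y \<in> V" for y
    using that V by (auto intro: inv_into_into)
  then have val: "compose V \<nu> ?g \<in> V \<rightarrow>\<^sub>E carrier (data_dom S)"
    if "\<nu> \<in> carrier ?M \<rightarrow>\<^sub>E carrier (data_dom S)" for \<nu>
    using that by (auto simp: compose_def)
  {
    case Nil
    then show ?case
      using val by (auto simp: embed_word_def Id_on_iff)
  next
    case (Cons p \<rho>)
    obtain \<sigma> v where p: "p = (\<sigma>, v)" by (cases p)
    have \<sigma>: "\<sigma> \<in> cmds S" and v: "v \<in> carrier ?M"
      using Cons.prems(1) p by auto
    from Cons.prems(3) obtain \<mu> where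
      step: "(\<nu>, \<mu>) \<in> Global1 S ?M (sem (P i)) (carrier ?M) p" and
      rest: "(\<mu>, \<nu>') \<in> Global S ?M (sem (P i)) (carrier ?M) \<rho>"
      by auto
    let ?N = "nbhd ?\<V> ?M v" and ?N' = "nbhd ?\<V> T (e i v)"
    have M: "is_structure ?\<V> ?M"
      using pp i by (simp add: parameterized_program_def is_program_def)
    have e: "embedding ?\<V> ?M T (e i)"
      using us i by (simp add: universal_structure_def)
    have N': "?N' = e i ` ?N"
      using generated_set_image_embedding[OF M e, of "{v}"] v by (simp add: nbhd_eq)
    have N: "?N \<subseteq> carrier ?M"
      using generated_set_subset_carrier[OF M, of "{v}"] v by (simp add: nbhd_eq)
    have N'V: "?N' \<subseteq> V"
      using Cons.prems(2) p by auto
    have ge: "?g (e i x) = x" if "x \<in> carrier ?M" for x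
      using that e by (simp add: embedding_def)
    \<comment> \<open>Restriction commutes with transport, which puts the restricted valuations into
      the form of elements of a \<open>pullback\<close>. Off \<open>?N'\<close> both sides are
      \<open>undefined\<close>.\<close>
    have restr: "restrict (compose V \<xi> ?g) ?N' = compose ?N' (restrict \<xi> ?N) ?g" for \<xi>
    proof
      fix y
      show "restrict (compose V \<xi> ?g) ?N' y = compose ?N' (restrict \<xi> ?N) ?g y"
      proof (cases "y \<in> ?N'")
        case True
        then have "y \<in> V" and "?g y \<in> ?N"
          using N'V N' N ge by auto
        then show ?thesis
          using True by (simp add: compose_def)
      qed (simp add: compose_def)
    qed
    have "(restrict (compose V \<nu> ?g) ?N', restrict (compose V \<mu> ?g) ?N')
        \<in> univ_sem S I P T \<sigma> (e i v)"
      using step p unfolding univ_sem_embedding[OF pp us i v \<sigma>] restr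
      by (force simp: Global1_def pullback_def)
    \<comment> \<open>The frame condition: since \<open>?N'\<close> is the image of
      \<open>?N\<close>, a node outside \<open>?N'\<close> comes from one outside \<open>?N\<close>,
      where \<nu> and \<mu> agree.\<close>
    moreover have "compose V \<nu> ?g y = compose V \<mu> ?g y" if y: "y \<in> V - ?N'" for y
    proof -
      obtain x where x: "x \<in> carrier ?M" "y = e i x"
        using V y by auto
      then have "x \<notin> ?N"
        using N' y by auto
      then have "\<nu> x = \<mu> x"
        using step p x by (auto simp: Global1_def)
      then show ?thesis
        using x y ge by (simp add: compose_def)
    qed
    ultimately have "(compose V \<nu> ?g, compose V \<mu> ?g)
        \<in> Global1 S T (univ_sem S I P T) V (\<sigma>, e i v)"
      using step p val by (simp add: Global1_def)
    moreover have "(compose V \<mu> ?g, compose V \<nu>' ?g)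
        \<in> Global S T (univ_sem S I P T) V (embed_word (e i) \<rho>)"
      using Cons.IH rest Cons.prems by simp
    ultimately show ?case
      using p by (auto simp: embed_word_def)
  }
qed

section \<open>Error runs and soundness\<close>

text \<open>Membership in \<open>cmds S\<close> matters because the members of a parameterized
  program are related only on those commands.\<close>

lemma error_runs_subset:
  assumes P: "is_program S P" and \<rho>: "\<rho> \<in> error_runs S P"
  shows "set \<rho> \<subseteq> cmds S \<times> carrier (topology P)"
proof
  fix p assume "p \<in> set \<rho>"
  then obtain k where "k < length \<rho>" "p = \<rho> ! k"
    by (auto simp: in_set_conv_nth)
  then obtain \<kappa> \<kappa>' where "loc_step S P \<kappa> p \<kappa>'"
    using \<rho> by (auto simp: error_runs_def)
  then show "p \<in> cmds S \<times> carrier (topology P)"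
    using P by (auto simp: loc_step_def is_program_def)
qed

theorem theorem5p7:
  fixes S :: "('nf, 'nr, 'df, 'dr, 'd, 's, 'l) setting"
    and I :: "'i set"
    and P :: "'i \<Rightarrow> ('n, 'nf, 'nr, 's, 'd) program"
  assumes "parameterized_program S I P"
    and "\<exists>(T :: ('u, 'nf, 'nr) struct) e H.
           universal_structure S I P T e \<and> valid_proof_space S I P T H \<and>
           (\<Union>i\<in>I. embed_word (e i) ` error_runs S (P i)) \<subseteq> proof_space_lang H"
  shows "safe_parameterized S I P"
proof -
  from assms(2) obtain T :: "('u, 'nf, 'nr) struct" and e H where
    us: "universal_structure S I P T e" and H: "valid_proof_space S I P T H" and
    incl: "(\<Union>i\<in>I. embed_word (e i) ` error_runs S (P i)) \<subseteq> proof_space_lang H"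
    by blast
  have "infeasible S (P i) \<rho>" if i: "i \<in> I" and \<rho>: "\<rho> \<in> error_runs S (P i)" for i \<rho>
  proof (rule ccontr)
    let ?\<V> = "node_voc S" and ?M = "topology (P i)"
    assume "\<not> infeasible S (P i) \<rho>"
    then obtain \<nu> \<nu>' where G: "(\<nu>, \<nu>') \<in> Global S ?M (sem (P i)) (carrier ?M) \<rho>"
      by (auto simp: infeasible_def)
    have prog: "is_program S (P i)"
      using assms(1) i by (simp add: parameterized_program_def)
    then have M: "is_structure ?\<V> ?M"
      by (simp add: is_program_def)
    have e: "embedding ?\<V> ?M T (e i)"
      using us i by (simp add: universal_structure_def)
    have sub: "set \<rho> \<subseteq> cmds S \<times> carrier ?M"
      using error_runs_subset[OF prog \<rho>] .
    then have acting: "snd ` set \<rho> \<subseteq> carrier ?M"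
      by auto
    \<comment> \<open>This is the node set in the validity of the triple: \<open>Tru\<close> and
      \<open>Fls\<close> have no free variables, so only the acting nodes generate it.\<close>
    define V where "V = generated_set ?\<V> T (snd ` set (embed_word (e i) \<rho>))"
    have snd_embed: "snd ` set (embed_word (e i) \<rho>) = e i ` snd ` set \<rho>"
      by (force simp: embed_word_def)
    have "V \<subseteq> e i ` carrier ?M"
      using generated_set_image_embedding[OF M e acting] generated_set_subset_carrier[OF M acting]
      by (auto simp: V_def snd_embed)
    moreover have "nbhd ?\<V> T (e i v) \<subseteq> V" if "v \<in> snd ` set \<rho>" for v
      unfolding nbhd_eq V_def snd_embed using that by (intro generated_set_mono) blast
    ultimately have "Global S T (univ_sem S I P T) V (embed_word (e i) \<rho>) \<noteq> {}"
      using Global_embedding[OF assms(1) us i sub _ _ G] by blast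
    moreover have "valid_triple S I P T (Tru, embed_word (e i) \<rho>, Fls)"
      using H incl i \<rho> by (auto simp: valid_proof_space_def proof_space_lang_def)
    \<comment> \<open>The transported pair starts in a valuation satisfying \<open>Tru\<close>, so
      validity would make its end satisfy \<open>Fls\<close>.\<close>
    ultimately show False
      by (auto simp: valid_triple_def satisfies_def gen_sub_def V_def)
  qed
  then show ?thesis
    by (simp add: safe_parameterized_def safe_def)
qed

end
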